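(* The curvilinear split-form DGSEM with the positivity-preserving limiter, the subcell shock-capturing and the well-balanced treatment of partially dry elements (all as described in the context) preserves the lake-at-rest condition of the multilayer shallow water equations, $$h_m\nabla\Big(b+\sum_{k\ge m}h_k+\sum_{k<m}\sigma_{km}h_k\Big)=0,\qquad v_m=w_m=0,\qquad m=1,\dots,M,$$ with wet and dry regions in arbitrary location: for every discrete lake-at-rest state, the semi-discrete update satisfies $\dot{\mathbf U}_{ij}=0$ at every node of every element and the limiter leaves the state unchanged.
   Context: Equations: $M\ge1$ layers, $g>0$, $0<\rho_1<\dots<\rho_M$, $\sigma_{km}=\rho_k/\rho_m$, bottom $b$. Two-dimensional multilayer shallow water equations $\mathbf u_t+\partial_x\mathbf f^1+\partial_y\mathbf f^2+\boldsymbol\phi\circ(\partial_x\mathbf r^1+\partial_y\mathbf r^2)=0$ ($\circ$ Hadamard product), $\mathbf u_m=(h_m,h_mv_m,h_mw_m)^T$, $\boldsymbol\phi_m=g(0,h_m,h_m)^T$, $\mathbf f^1_m=(h_mv_m,h_mv_m^2,h_mv_mw_m)^T$, $\mathbf f^2_m=(h_mw_m,h_mv_mw_m,h_mw_m^2)^T$, $\mathbf r^1_m=(0,p_m,0)^T$, $\mathbf r^2_m=(0,0,p_m)^T$, $p_m=b+\sum_{k\ge m}h_k+\sum_{k<m}\sigma_{km}h_k$. Mesh and operators: $K$ non-overlapping conforming curvilinear quadrilaterals, periodic boundaries, each the image of $E=[-1,1]^2$ with Jacobian $J>0$ and nodal contravariant vectors $J\vec a^{\,1},J\vec a^{\,2}\in\mathbb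 R^2$. Tensor-product Legendre-Gauss-Lobatto (LGL) nodes of degree $N$, 1D weights $\omega_i$, $\omega_{ij}=\omega_i\omega_j$, differentiation matrix $\mathcal D_{ij}=\ell_j'(\xi_i)$, $\mathcal Q_{ij}=\omega_i\mathcal D_{ij}$. Discrete metric identities: $\sum_l\mathcal D_{il}(J\vec a^{\,1})_{lj}+\sum_l\mathcal D_{jl}(J\vec a^{\,2})_{il}=0$. $\langle f,g\rangle_N=\sum_{i,j}f_{ij}^Tg_{ij}\omega_{ij}$; $\int_{\partial E,N}$ is LGL quadrature on edges; $\vec n$ outward unit normal, $\hat s$ surface element with $\hat s\vec n=\pm J\vec a^{\,1}$ or $\pm J\vec a^{\,2}$ on the edges $\xi=\pm1$, $\eta=\pm1$. $\mathbf U,\boldsymbol\Phi,\mathbf R,\mathbf F$ are nodal values of $\mathbf u,\boldsymbol\phi,(\mathbf r^1,\mathbf r^2),(\mathbf f^1,\mathbf f^2)$; for $\vec d\in\mathbb R^2$, $\mathbf F\cdot\vec d=d_1\mathbf F^1+d_2\mathbf F^2$. Interface terms with hydrostatic reconstruction: for two neighbouring values $-$ (inner) and $+$ (outer), with $H_m=b+\sum_{k\ge m}h_k$: $b_\epsilon^\pm=\min(H_1^\pm,\max(b^-,b^+))$, $H_{m,\epsilon}^\pm=\max(H_m^\pm,b_\epsilon^\pm)$, $h_{M,\epsilon}^\pm=H_{M,\epsilon}^\pm-b_\epsilon^\pm$, $h_{m,\epsilon}^\pm=H_{m,\epsilon}^\pm-H_{m+1,\epsilon}^\pm$ ($m<M$),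 $\mathbf U_{m,\epsilon}^\pm=h_{m,\epsilon}^\pm(1,v_m^\pm,w_m^\pm)^T$; $\boldsymbol\Phi_\epsilon,\mathbf R_\epsilon$ use $h_{m,\epsilon},b_\epsilon$. With unit normal $\vec n$: $\mathbf F^{ES}_{n,\epsilon}=\mathbf F^{EC}(\mathbf U_\epsilon^-,\mathbf U_\epsilon^+)\cdot\vec n-\frac12|\lambda_{\max}|(\mathbf U_\epsilon^+-\mathbf U_\epsilon^-)$, $(\boldsymbol\Phi\circ\mathbf R)^\diamond_{n,\epsilon}=\frac12\boldsymbol\Phi_\epsilon^-\circ(\mathbf R_\epsilon^+-\mathbf R_\epsilon^-)\cdot\vec n$, where (arithmetic means $\{\!\{\cdot\}\!\}$) $\mathbf F^{EC,1}_m=(\{\!\{h_mv_m\}\!\},\{\!\{h_mv_m\}\!\}\{\!\{v_m\}\!\},\{\!\{h_mv_m\}\!\}\{\!\{w_m\}\!\})^T$, $\mathbf F^{EC,2}_m=(\{\!\{h_mw_m\}\!\},\{\!\{h_mw_m\}\!\}\{\!\{v_m\}\!\},\{\!\{h_mw_m\}\!\}\{\!\{w_m\}\!\})^T$, and, with $v_{n,m}=n_1v_m+n_2w_m$, $\lambda_{\max}=\max\big(\big|\frac{\sum_mh_m^+v_{n,m}^+}{\sum_mh_m^+}\big|,\big|\frac{\sum_mh_m^-v_{n,m}^-}{\sum_mh_m^-}\big|,\max_m|v_{n,m}^\pm|\big)+\max\big(\sqrt{g\sum_mh_m^+},\sqrt{g\sum_mh_m^-}\big)$ (quotients with zero denominator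 omitted). DG update $\dot{\mathbf U}^{DG}$: for all nodal polynomial test functions $\boldsymbol\varphi$, $\langle J\dot{\mathbf U}^{DG},\boldsymbol\varphi\rangle_N+\int_{\partial E,N}\boldsymbol\varphi^T\{\mathbf F^{ES}_{n,\epsilon}-\mathbf F_n\}\hat s\,dS+\langle\vec{\mathbb D}\cdot\tilde{\mathbf F}^{EC},\boldsymbol\varphi\rangle_N+\int_{\partial E,N}\boldsymbol\varphi^T(\boldsymbol\Phi\circ\mathbf R)^\diamond_{n,\epsilon}\hat s\,dS+\langle\vec{\mathbb D}\cdot(\boldsymbol\Phi\circ\tilde{\mathbf R})^\diamond,\boldsymbol\varphi\rangle_N=0$, where $\mathbf F_n=\mathbf F\cdot\vec n$ and, at node $ij$, $\vec{\mathbb D}\cdot\tilde{\mathbf F}^{EC}=2\sum_l\mathcal D_{il}\mathbf F^{EC}(\mathbf U_{ij},\mathbf U_{lj})\cdot\frac12((J\vec a^{\,1})_{ij}+(J\vec a^{\,1})_{lj})+2\sum_l\mathcal D_{jl}\mathbf F^{EC}(\mathbf U_{ij},\mathbf U_{il})\cdot\frac12((J\vec a^{\,2})_{ij}+(J\vec a^{\,2})_{il})$; $\vec{\mathbb D}\cdot(\boldsymbol\Phi\circ\tilde{\mathbf R})^\diamond$ is the same with the two-point flux replaced by $\frac12\boldsymbol\Phi_{ij}\circ(\mathbf R_{lj}-\mathbf R_{ij})$, resp. $\frac12\boldsymbol\Phi_{ij}\circ(\mathbf R_{il}-\mathbf R_{ij})$. In the volume terms no reconstruction is used. Subcell FV update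 $\dot{\mathbf U}^{FV}$: each node $ij$ is a subcell of reference size $\omega_i\times\omega_j$; the interface between nodes $(i,j)$ and $(i+1,j)$ has scaled normal $(J\vec a^{\,1})_{0j}+\sum_{m=0}^i\sum_{l=0}^N\mathcal Q_{ml}(J\vec a^{\,1})_{lj}$, analogously in the $\eta$-direction, and on element edges the interfaces and scaled normals coincide with those of the DG surface terms. Then $J_{ij}\omega_{ij}\dot{\mathbf U}^{FV}_{ij}$ is minus the sum over the four subcell interfaces of (scaled normal length) $\times$ (transverse weight $\omega_j$ or $\omega_i$) $\times\big(\mathbf F^{ES}_{n,\epsilon}+(\boldsymbol\Phi\circ\mathbf R)^\diamond_{n,\epsilon}\big)$, with outward unit normals and the two adjacent nodal values (node $ij$ being the inner one). Shock capturing and well-balanced treatment: $\dot{\mathbf U}_{ij}=(1-\alpha)\dot{\mathbf U}^{DG}_{ij}+\alpha\dot{\mathbf U}^{FV}_{ij}$ with one $\alpha\in[0,1]$ per element given by a shock indicator, except that $\alpha=1$ is enforced in every partially dry element, i.e. every element in which some $h_m$ at some node lies below a threshold $\tau_{wet}>0$. Positivity limiter: in each element and each layer, $(h_m)_{ij}$ is replaced by $\theta\big((h_m)_{ij}-\bar h_m\big)+\bar h_m$, where $\bar h_m$ is the cell average and $\theta=\min\{1,\bar h_m/(\bar h_m-\min_{ij}(h_m)_{ij})\}$ ($\theta=1$ if the denominator vanishes). Discrete lake-at-rest state: nodal values with $h_m\ge0$ and $v_m=w_m=0$ for all $m$ such that for any two adjacent nodal values (adjacent nodes in $\xi$- or $\eta$-direction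 within an element, or the two traces at an element interface) there are constants $C_1\ge\dots\ge C_M$ with $H_m^\pm=\max(C_m,b^\pm)$ for all $m$ (each total layer height is constant where the layer is wet). *)

theory Defs
  imports "HOL-Analysis.Analysis" "HOL-Computational_Algebra.Polynomial"
begin

text \<open>Rodrigues' formula.\<close>
definition legendre :: "nat \<Rightarrow> real poly" where
  "legendre n = smult (1 / (2 ^ n * fact n)) ((pderiv ^^ n) ([:-1, 0, 1:] ^ n))"

text \<open>Together with strict monotonicity the conditions determine the nodes: the derivative of the
  Legendre polynomial has degree \<open>N - 1\<close>, so the interior nodes are all of its roots.\<close>
definition lgl_nodes :: "nat \<Rightarrow> (nat \<Rightarrow> real) \<Rightarrow> bool" where
  "lgl_nodes N x \<longleftrightarrow> strict_mono_on {..N} x \<and> x 0 = -1 \<and> x N = 1 \<and>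
     (\<forall>i\<in>{0<..<N}. poly (pderiv (legendre N)) (x i) = 0)"

definition lagrange :: "nat \<Rightarrow> (nat \<Rightarrow> real) \<Rightarrow> nat \<Rightarrow> real poly" where
  "lagrange N x j = (\<Prod>k\<in>{..N} - {j}. smult (1 / (x j - x k)) [:- x k, 1:])"

definition weight :: "nat \<Rightarrow> (nat \<Rightarrow> real) \<Rightarrow> nat \<Rightarrow> real" where
  "weight N x i = integral {-1..1} (poly (lagrange N x i))"

definition Dmat :: "nat \<Rightarrow> (nat \<Rightarrow> real) \<Rightarrow> nat \<Rightarrow> nat \<Rightarrow> real" where
  "Dmat N x i j = poly (pderiv (lagrange N x j)) (x i)"

definition Qmat :: "nat \<Rightarrow> (nat \<Rightarrow> real) \<Rightarrow> nat \<Rightarrow> nat \<Rightarrow> real" where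
  "Qmat N x i j = weight N x i * Dmat N x i j"

text \<open>The sides \<open>\<xi> = -1\<close>, \<open>\<xi> = 1\<close>, \<open>\<eta> = -1\<close>, \<open>\<eta> = 1\<close> of the reference square.\<close>
datatype side = West | East | South | North

text \<open>Elements are numbered \<open>0, \<dots>, nelem - 1\<close>. The entry \<open>nbr e s = (e', s', r)\<close> says that side \<open>s\<close>
  of \<open>e\<close> is glued to side \<open>s'\<close> of \<open>e'\<close>; \<open>r\<close> records whether the two edge parametrizations run in
  opposite directions. Periodic neighbours are included.\<close>
record mesh =
  nelem :: nat
  emap :: "nat \<Rightarrow> real \<Rightarrow> real \<Rightarrow> real^2"
  nbr :: "nat \<Rightarrow> side \<Rightarrow> nat \<times> side \<times> bool"

definition elem :: "mesh \<Rightarrow> nat \<Rightarrow> (real^2) set" where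
  "elem T e = (\<lambda>(\<xi>, \<eta>). emap T e \<xi> \<eta>) ` ({-1..1} \<times> {-1..1})"

definition domain :: "mesh \<Rightarrow> (real^2) set" where
  "domain T = (\<Union>e<nelem T. elem T e)"

fun side_point :: "side \<Rightarrow> real \<Rightarrow> real \<times> real" where
  "side_point West t = (-1, t)"
| "side_point East t = (1, t)"
| "side_point South t = (t, -1)"
| "side_point North t = (t, 1)"

definition edge :: "mesh \<Rightarrow> nat \<Rightarrow> side \<Rightarrow> real \<Rightarrow> real^2" where
  "edge T e s t = (case side_point s t of (\<xi>, \<eta>) \<Rightarrow> emap T e \<xi> \<eta>)"

definition map_xi :: "mesh \<Rightarrow> nat \<Rightarrow> real \<Rightarrow> real \<Rightarrow> real^2" where
  "map_xi T e \<xi> \<eta> = vector_derivative (\<lambda>s. emap T e s \<eta>) (at \<xi> within {-1..1})"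

definition map_eta :: "mesh \<Rightarrow> nat \<Rightarrow> real \<Rightarrow> real \<Rightarrow> real^2" where
  "map_eta T e \<xi> \<eta> = vector_derivative (\<lambda>s. emap T e \<xi> s) (at \<eta> within {-1..1})"

definition jac :: "mesh \<Rightarrow> nat \<Rightarrow> real \<Rightarrow> real \<Rightarrow> real" where
  "jac T e \<xi> \<eta> = map_xi T e \<xi> \<eta> $ 1 * map_eta T e \<xi> \<eta> $ 2
                  - map_eta T e \<xi> \<eta> $ 1 * map_xi T e \<xi> \<eta> $ 2"

text \<open>The contravariant vectors are \<open>J \<nabla>\<xi>\<close> and \<open>J \<nabla>\<eta>\<close>, written out by
  Cramer's rule.\<close>
definition contra1 :: "mesh \<Rightarrow> nat \<Rightarrow> real \<Rightarrow> real \<Rightarrow> real^2" where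
  "contra1 T e \<xi> \<eta> = vector [map_eta T e \<xi> \<eta> $ 2, - map_eta T e \<xi> \<eta> $ 1]"

definition contra2 :: "mesh \<Rightarrow> nat \<Rightarrow> real \<Rightarrow> real \<Rightarrow> real^2" where
  "contra2 T e \<xi> \<eta> = vector [- map_xi T e \<xi> \<eta> $ 2, map_xi T e \<xi> \<eta> $ 1]"

definition Jn :: "(nat \<Rightarrow> real) \<Rightarrow> mesh \<Rightarrow> nat \<Rightarrow> nat \<Rightarrow> nat \<Rightarrow> real" where
  "Jn x T e i j = jac T e (x i) (x j)"

definition Ja1 :: "(nat \<Rightarrow> real) \<Rightarrow> mesh \<Rightarrow> nat \<Rightarrow> nat \<Rightarrow> nat \<Rightarrow> real^2" where
  "Ja1 x T e i j = contra1 T e (x i) (x j)"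

definition Ja2 :: "(nat \<Rightarrow> real) \<Rightarrow> mesh \<Rightarrow> nat \<Rightarrow> nat \<Rightarrow> nat \<Rightarrow> real^2" where
  "Ja2 x T e i j = contra2 T e (x i) (x j)"

fun side_node :: "nat \<Rightarrow> side \<Rightarrow> nat \<Rightarrow> nat \<times> nat" where
  "side_node N West t = (0, t)"
| "side_node N East t = (N, t)"
| "side_node N South t = (t, 0)"
| "side_node N North t = (t, N)"

text \<open>The outward normal scaled by the surface element, at the \<open>t\<close>-th node of a side.\<close>
fun side_normal :: "nat \<Rightarrow> (nat \<Rightarrow> real) \<Rightarrow> mesh \<Rightarrow> nat \<Rightarrow> side \<Rightarrow> nat \<Rightarrow> real^2" where
  "side_normal N x T e West t = - Ja1 x T e 0 t"
| "side_normal N x T e East t = Ja1 x T e N t"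
| "side_normal N x T e South t = - Ja2 x T e t 0"
| "side_normal N x T e North t = Ja2 x T e t N"

definition inner_node :: "nat \<Rightarrow> nat \<Rightarrow> side \<Rightarrow> nat \<Rightarrow> nat \<times> nat \<times> nat" where
  "inner_node N e s t = (e, side_node N s t)"

text \<open>The LGL nodes are symmetric about 0, so reversing an edge maps its node \<open>t\<close> to \<open>N - t\<close>.\<close>
definition outer_node :: "nat \<Rightarrow> mesh \<Rightarrow> nat \<Rightarrow> side \<Rightarrow> nat \<Rightarrow> nat \<times> nat \<times> nat" where
  "outer_node N T e s t =
     (case nbr T e s of (e', s', r) \<Rightarrow> inner_node N e' s' (if r then N - t else t))"

text \<open>Matched edges coincide pointwise up to a translation \<open>c\<close>, which may be nonzero only on the
  boundary of the domain (periodicity).\<close>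
definition conforming :: "nat \<Rightarrow> (nat \<Rightarrow> real) \<Rightarrow> mesh \<Rightarrow> bool" where
  "conforming N x T \<longleftrightarrow> (\<forall>e<nelem T. \<forall>s. case nbr T e s of (e', s', r) \<Rightarrow>
     e' < nelem T \<and> nbr T e' s' = (e, s, r) \<and>
     (\<exists>c. (\<forall>t\<in>{-1..1}. edge T e' s' (if r then - t else t) = edge T e s t + c) \<and>
          (c = 0 \<or> edge T e s ` {-1..1} \<subseteq> frontier (domain T))) \<and>
     (\<forall>t\<le>N. side_normal N x T e' s' (if r then N - t else t) = - side_normal N x T e s t))"

definition metric_identities :: "nat \<Rightarrow> (nat \<Rightarrow> real) \<Rightarrow> mesh \<Rightarrow> bool" where
  "metric_identities N x T \<longleftrightarrow> (\<forall>e<nelem T. \<forall>i\<le>N. \<forall>j\<le>N.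
     (\<Sum>l\<le>N. Dmat N x i l *\<^sub>R Ja1 x T e l j) + (\<Sum>l\<le>N. Dmat N x j l *\<^sub>R Ja2 x T e i l) = 0)"

definition valid_mesh :: "nat \<Rightarrow> (nat \<Rightarrow> real) \<Rightarrow> mesh \<Rightarrow> bool" where
  "valid_mesh N x T \<longleftrightarrow>
     0 < nelem T \<and>
     (\<forall>e<nelem T.
        (\<lambda>(\<xi>, \<eta>). emap T e \<xi> \<eta>) differentiable_on ({-1..1} \<times> {-1..1}) \<and>
        inj_on (\<lambda>(\<xi>, \<eta>). emap T e \<xi> \<eta>) ({-1..1} \<times> {-1..1}) \<and>
        (\<forall>\<xi>\<in>{-1..1}. \<forall>\<eta>\<in>{-1..1}. 0 < jac T e \<xi> \<eta>)) \<and>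
     (\<forall>e<nelem T. \<forall>e'<nelem T. e \<noteq> e' \<longrightarrow> interior (elem T e) \<inter> interior (elem T e') = {}) \<and>
     conforming N x T \<and>
     metric_identities N x T"

text \<open>Layers are numbered \<open>1, \<dots>, M\<close>. Nodal data are given in primitive variables, so that
  velocities are meaningful in dry layers too.\<close>
record nodal =
  ht :: "nat \<Rightarrow> real"
  vx :: "nat \<Rightarrow> real"
  vy :: "nat \<Rightarrow> real"
  bed :: real

definition surf :: "nat \<Rightarrow> nodal \<Rightarrow> nat \<Rightarrow> real" where
  "surf M q m = bed q + (\<Sum>k=m..M. ht q k)"

definition press :: "nat \<Rightarrow> (nat \<Rightarrow> real) \<Rightarrow> nodal \<Rightarrow> nat \<Rightarrow> real" where
  "press M \<rho> q m = bed q + (\<Sum>k=m..M. ht q k) + (\<Sum>k=1..<m. \<rho> k / \<rho> m * ht q k)"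

definition cons_var :: "nodal \<Rightarrow> nat \<Rightarrow> real^3" where
  "cons_var q m = vector [ht q m, ht q m * vx q m, ht q m * vy q m]"

definition Phi :: "real \<Rightarrow> nodal \<Rightarrow> nat \<Rightarrow> real^3" where
  "Phi g q m = g *\<^sub>R vector [0, ht q m, ht q m]"

definition flux :: "nodal \<Rightarrow> real^2 \<Rightarrow> nat \<Rightarrow> real^3" where
  "flux q d m =
     d $ 1 *\<^sub>R vector [ht q m * vx q m, ht q m * (vx q m)\<^sup>2, ht q m * vx q m * vy q m] +
     d $ 2 *\<^sub>R vector [ht q m * vy q m, ht q m * vx q m * vy q m, ht q m * (vy q m)\<^sup>2]"

definition Rdot :: "nat \<Rightarrow> (nat \<Rightarrow> real) \<Rightarrow> nodal \<Rightarrow> real^2 \<Rightarrow> nat \<Rightarrow> real^3" where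
  "Rdot M \<rho> q d m =
     d $ 1 *\<^sub>R vector [0, press M \<rho> q m, 0] + d $ 2 *\<^sub>R vector [0, 0, press M \<rho> q m]"

definition avg :: "real \<Rightarrow> real \<Rightarrow> real" where
  "avg a b = (a + b) / 2"

definition ec_flux :: "nodal \<Rightarrow> nodal \<Rightarrow> real^2 \<Rightarrow> nat \<Rightarrow> real^3" where
  "ec_flux q q' d m =
     (let hv = avg (ht q m * vx q m) (ht q' m * vx q' m);
          hw = avg (ht q m * vy q m) (ht q' m * vy q' m);
          v = avg (vx q m) (vx q' m);
          w = avg (vy q m) (vy q' m)
      in d $ 1 *\<^sub>R vector [hv, hv * v, hv * w] + d $ 2 *\<^sub>R vector [hw, hw * v, hw * w])"

text \<open>On \<open>real^3\<close> the operation \<open>*\<close> is the Hadamard product.\<close>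
definition nc_term ::
  "real \<Rightarrow> nat \<Rightarrow> (nat \<Rightarrow> real) \<Rightarrow> nodal \<Rightarrow> nodal \<Rightarrow> real^2 \<Rightarrow> nat \<Rightarrow> real^3" where
  "nc_term g M \<rho> q q' d m = (1/2) *\<^sub>R (Phi g q m * (Rdot M \<rho> q' d m - Rdot M \<rho> q d m))"

text \<open>In all functions of two nodal states the first one is the inner value. The reconstruction of
  the outer value is obtained by swapping the arguments.\<close>
definition rec_bed :: "nat \<Rightarrow> nodal \<Rightarrow> nodal \<Rightarrow> real" where
  "rec_bed M q q' = min (surf M q 1) (max (bed q) (bed q'))"

definition rec_surf :: "nat \<Rightarrow> nodal \<Rightarrow> nodal \<Rightarrow> nat \<Rightarrow> real" where
  "rec_surf M q q' m = max (surf M q m) (rec_bed M q q')"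

definition recon :: "nat \<Rightarrow> nodal \<Rightarrow> nodal \<Rightarrow> nodal" where
  "recon M q q' = q\<lparr>
     ht := (\<lambda>m. if m = M then rec_surf M q q' M - rec_bed M q q'
                 else rec_surf M q q' m - rec_surf M q q' (m + 1)),
     bed := rec_bed M q q'\<rparr>"

definition vn :: "nodal \<Rightarrow> real^2 \<Rightarrow> nat \<Rightarrow> real" where
  "vn q n m = n $ 1 * vx q m + n $ 2 * vy q m"

text \<open>A quotient with zero denominator evaluates to 0, which does not affect the maximum
  of nonnegative numbers.\<close>
definition lambda_max :: "real \<Rightarrow> nat \<Rightarrow> nodal \<Rightarrow> nodal \<Rightarrow> real^2 \<Rightarrow> real" where
  "lambda_max g M q q' n =
     max (max \<bar>(\<Sum>m=1..M. ht q' m * vn q' n m) / (\<Sum>m=1..M. ht q' m)\<bar>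
              \<bar>(\<Sum>m=1..M. ht q m * vn q n m) / (\<Sum>m=1..M. ht q m)\<bar>)
         (Max ((\<lambda>m. max \<bar>vn q n m\<bar> \<bar>vn q' n m\<bar>) ` {1..M})) +
     max (sqrt (g * (\<Sum>m=1..M. ht q' m))) (sqrt (g * (\<Sum>m=1..M. ht q m)))"

definition es_flux :: "real \<Rightarrow> nat \<Rightarrow> nodal \<Rightarrow> nodal \<Rightarrow> real^2 \<Rightarrow> nat \<Rightarrow> real^3" where
  "es_flux g M q q' n m =
     ec_flux (recon M q q') (recon M q' q) n m
     - (1/2 * \<bar>lambda_max g M q q' n\<bar>) *\<^sub>R
         (cons_var (recon M q' q) m - cons_var (recon M q q') m)"

definition nc_interface ::
  "real \<Rightarrow> nat \<Rightarrow> (nat \<Rightarrow> real) \<Rightarrow> nodal \<Rightarrow> nodal \<Rightarrow> real^2 \<Rightarrow> nat \<Rightarrow> real^3" where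
  "nc_interface g M \<rho> q q' n m = nc_term g M \<rho> (recon M q q') (recon M q' q) n m"

text \<open>A discrete state assigns nodal data to \<open>(e, i, j)\<close>. Fields on one element with values in
  \<open>\<real>\<^sup>3\<^sup>M\<close> are functions of \<open>i\<close>, \<open>j\<close> and the layer.\<close>
type_synonym state = "nat \<times> nat \<times> nat \<Rightarrow> nodal"
type_synonym field = "nat \<Rightarrow> nat \<Rightarrow> nat \<Rightarrow> real^3"

definition inner_N :: "nat \<Rightarrow> nat \<Rightarrow> (nat \<Rightarrow> real) \<Rightarrow> field \<Rightarrow> field \<Rightarrow> real" where
  "inner_N M N x f f' =
     (\<Sum>i\<le>N. \<Sum>j\<le>N. (\<Sum>m=1..M. f i j m \<bullet> f' i j m) * (weight N x i * weight N x j))"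

definition sides :: "side set" where
  "sides = {West, East, South, North}"

text \<open>LGL quadrature over the edges of element \<open>e\<close>, the surface element being the norm of the
  scaled normal; \<open>f\<close> is given at the \<open>t\<close>-th node of each side.\<close>
definition surface_N ::
  "nat \<Rightarrow> nat \<Rightarrow> (nat \<Rightarrow> real) \<Rightarrow> mesh \<Rightarrow> nat \<Rightarrow> field \<Rightarrow> (side \<Rightarrow> nat \<Rightarrow> nat \<Rightarrow> real^3) \<Rightarrow> real" where
  "surface_N M N x T e \<phi> f =
     (\<Sum>s\<in>sides. \<Sum>t\<le>N. case side_node N s t of (i, j) \<Rightarrow>
        (\<Sum>m=1..M. \<phi> i j m \<bullet> f s t m) * norm (side_normal N x T e s t) * weight N x t)"

definition split_div ::
  "nat \<Rightarrow> (nat \<Rightarrow> real) \<Rightarrow> mesh \<Rightarrow> (nodal \<Rightarrow> nodal \<Rightarrow> real^2 \<Rightarrow> nat \<Rightarrow> real^3) \<Rightarrow> state \<Rightarrow> nat \<Rightarrow> field"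
  where
  "split_div N x T F S e i j m =
     2 *\<^sub>R (\<Sum>l\<le>N. Dmat N x i l *\<^sub>R
        F (S (e, i, j)) (S (e, l, j)) ((1/2) *\<^sub>R (Ja1 x T e i j + Ja1 x T e l j)) m) +
     2 *\<^sub>R (\<Sum>l\<le>N. Dmat N x j l *\<^sub>R
        F (S (e, i, j)) (S (e, i, l)) ((1/2) *\<^sub>R (Ja2 x T e i j + Ja2 x T e i l)) m)"

definition dg_update ::
  "real \<Rightarrow> nat \<Rightarrow> (nat \<Rightarrow> real) \<Rightarrow> nat \<Rightarrow> (nat \<Rightarrow> real) \<Rightarrow> mesh \<Rightarrow> state \<Rightarrow> nat \<Rightarrow> field \<Rightarrow> bool" where
  "dg_update g M \<rho> N x T S e Ud \<longleftrightarrow> (\<forall>\<phi> :: field.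
     inner_N M N x (\<lambda>i j m. Jn x T e i j *\<^sub>R Ud i j m) \<phi>
     + surface_N M N x T e \<phi> (\<lambda>s t m.
         let q = S (inner_node N e s t); q' = S (outer_node N T e s t);
             n = sgn (side_normal N x T e s t)
         in es_flux g M q q' n m - flux q n m)
     + inner_N M N x (split_div N x T ec_flux S e) \<phi>
     + surface_N M N x T e \<phi> (\<lambda>s t m.
         let q = S (inner_node N e s t); q' = S (outer_node N T e s t);
             n = sgn (side_normal N x T e s t)
         in nc_interface g M \<rho> q q' n m)
     + inner_N M N x (split_div N x T (nc_term g M \<rho>) S e) \<phi> = 0)"

text \<open>Scaled normals of the subcell interface between \<open>(i, j)\<close> and \<open>(i + 1, j)\<close>,
  respectively \<open>(i, j)\<close> and \<open>(i, j + 1)\<close>.\<close>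
definition sub_normal1 :: "nat \<Rightarrow> (nat \<Rightarrow> real) \<Rightarrow> mesh \<Rightarrow> nat \<Rightarrow> nat \<Rightarrow> nat \<Rightarrow> real^2" where
  "sub_normal1 N x T e i j = Ja1 x T e 0 j + (\<Sum>m\<le>i. \<Sum>l\<le>N. Qmat N x m l *\<^sub>R Ja1 x T e l j)"

definition sub_normal2 :: "nat \<Rightarrow> (nat \<Rightarrow> real) \<Rightarrow> mesh \<Rightarrow> nat \<Rightarrow> nat \<Rightarrow> nat \<Rightarrow> real^2" where
  "sub_normal2 N x T e i j = Ja2 x T e i 0 + (\<Sum>m\<le>j. \<Sum>l\<le>N. Qmat N x m l *\<^sub>R Ja2 x T e i l)"

fun sub_normal :: "nat \<Rightarrow> (nat \<Rightarrow> real) \<Rightarrow> mesh \<Rightarrow> nat \<Rightarrow> nat \<Rightarrow> nat \<Rightarrow> side \<Rightarrow> real^2" where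
  "sub_normal N x T e i j West =
     (if i = 0 then side_normal N x T e West j else - sub_normal1 N x T e (i - 1) j)"
| "sub_normal N x T e i j East =
     (if i = N then side_normal N x T e East j else sub_normal1 N x T e i j)"
| "sub_normal N x T e i j South =
     (if j = 0 then side_normal N x T e South i else - sub_normal2 N x T e i (j - 1))"
| "sub_normal N x T e i j North =
     (if j = N then side_normal N x T e North i else sub_normal2 N x T e i j)"

fun sub_outer :: "nat \<Rightarrow> mesh \<Rightarrow> nat \<Rightarrow> nat \<Rightarrow> nat \<Rightarrow> side \<Rightarrow> nat \<times> nat \<times> nat" where
  "sub_outer N T e i j West = (if i = 0 then outer_node N T e West j else (e, i - 1, j))"
| "sub_outer N T e i j East = (if i = N then outer_node N T e East j else (e, i + 1, j))"
| "sub_outer N T e i j South = (if j = 0 then outer_node N T e South i else (e, i, j - 1))"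
| "sub_outer N T e i j North = (if j = N then outer_node N T e North i else (e, i, j + 1))"

fun trans_weight :: "nat \<Rightarrow> (nat \<Rightarrow> real) \<Rightarrow> nat \<Rightarrow> nat \<Rightarrow> side \<Rightarrow> real" where
  "trans_weight N x i j West = weight N x j"
| "trans_weight N x i j East = weight N x j"
| "trans_weight N x i j South = weight N x i"
| "trans_weight N x i j North = weight N x i"

definition fv_update ::
  "real \<Rightarrow> nat \<Rightarrow> (nat \<Rightarrow> real) \<Rightarrow> nat \<Rightarrow> (nat \<Rightarrow> real) \<Rightarrow> mesh \<Rightarrow> state \<Rightarrow> nat \<Rightarrow> field \<Rightarrow> bool" where
  "fv_update g M \<rho> N x T S e Ud \<longleftrightarrow> (\<forall>i\<le>N. \<forall>j\<le>N. \<forall>m\<in>{1..M}.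
     (Jn x T e i j * (weight N x i * weight N x j)) *\<^sub>R Ud i j m =
     - (\<Sum>s\<in>sides.
          let nu = sub_normal N x T e i j s; q = S (e, i, j); q' = S (sub_outer N T e i j s)
          in (norm nu * trans_weight N x i j s) *\<^sub>R
               (es_flux g M q q' (sgn nu) m + nc_interface g M \<rho> q q' (sgn nu) m)))"

definition partially_dry :: "nat \<Rightarrow> nat \<Rightarrow> real \<Rightarrow> state \<Rightarrow> nat \<Rightarrow> bool" where
  "partially_dry M N \<tau> S e \<longleftrightarrow> (\<exists>i\<le>N. \<exists>j\<le>N. \<exists>m\<in>{1..M}. ht (S (e, i, j)) m < \<tau>)"

definition blending :: "nat \<Rightarrow> nat \<Rightarrow> real \<Rightarrow> (nat \<Rightarrow> real) \<Rightarrow> state \<Rightarrow> nat \<Rightarrow> real" where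
  "blending M N \<tau> ind S e = (if partially_dry M N \<tau> S e then 1 else ind e)"

text \<open>\<open>ind e\<close> is the value of the shock indicator on element \<open>e\<close>.\<close>
definition semidiscrete_update ::
  "real \<Rightarrow> nat \<Rightarrow> (nat \<Rightarrow> real) \<Rightarrow> nat \<Rightarrow> (nat \<Rightarrow> real) \<Rightarrow> mesh \<Rightarrow> real \<Rightarrow> (nat \<Rightarrow> real) \<Rightarrow>
   state \<Rightarrow> (nat \<Rightarrow> field) \<Rightarrow> bool" where
  "semidiscrete_update g M \<rho> N x T \<tau> ind S Ud \<longleftrightarrow> (\<forall>e<nelem T. \<exists>UDG UFV.
     dg_update g M \<rho> N x T S e UDG \<and> fv_update g M \<rho> N x T S e UFV \<and>
     (\<forall>i\<le>N. \<forall>j\<le>N. \<forall>m\<in>{1..M}. Ud e i j m =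
        (1 - blending M N \<tau> ind S e) *\<^sub>R UDG i j m + blending M N \<tau> ind S e *\<^sub>R UFV i j m))"

definition cell_avg :: "nat \<Rightarrow> (nat \<Rightarrow> real) \<Rightarrow> mesh \<Rightarrow> state \<Rightarrow> nat \<Rightarrow> nat \<Rightarrow> real" where
  "cell_avg N x T S e m =
     (\<Sum>i\<le>N. \<Sum>j\<le>N. Jn x T e i j * (weight N x i * weight N x j) * ht (S (e, i, j)) m) /
     (\<Sum>i\<le>N. \<Sum>j\<le>N. Jn x T e i j * (weight N x i * weight N x j))"

definition limiter_theta :: "nat \<Rightarrow> (nat \<Rightarrow> real) \<Rightarrow> mesh \<Rightarrow> state \<Rightarrow> nat \<Rightarrow> nat \<Rightarrow> real" where
  "limiter_theta N x T S e m =
     (let a = cell_avg N x T S e m;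
          d = a - Min ((\<lambda>(i, j). ht (S (e, i, j)) m) ` ({..N} \<times> {..N}))
      in if d = 0 then 1 else min 1 (a / d))"

text \<open>The limiter changes the layer heights only and keeps the momenta.\<close>
definition limited :: "nat \<Rightarrow> (nat \<Rightarrow> real) \<Rightarrow> mesh \<Rightarrow> state \<Rightarrow> nat \<Rightarrow> field" where
  "limited N x T S e i j m =
     (let a = cell_avg N x T S e m; q = S (e, i, j)
      in vector [limiter_theta N x T S e m * (ht q m - a) + a, ht q m * vx q m, ht q m * vy q m])"

definition level_pair :: "nat \<Rightarrow> nodal \<Rightarrow> nodal \<Rightarrow> bool" where
  "level_pair M q q' \<longleftrightarrow> (\<exists>C :: nat \<Rightarrow> real. (\<forall>m\<in>{1..<M}. C (m + 1) \<le> C m) \<and>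
     (\<forall>m\<in>{1..M}. surf M q m = max (C m) (bed q) \<and> surf M q' m = max (C m) (bed q')))"

definition lake_at_rest :: "nat \<Rightarrow> nat \<Rightarrow> mesh \<Rightarrow> state \<Rightarrow> bool" where
  "lake_at_rest M N T S \<longleftrightarrow> (\<forall>e<nelem T.
     (\<forall>i\<le>N. \<forall>j\<le>N. \<forall>m\<in>{1..M}.
        0 \<le> ht (S (e, i, j)) m \<and> vx (S (e, i, j)) m = 0 \<and> vy (S (e, i, j)) m = 0) \<and>
     (\<forall>i<N. \<forall>j\<le>N. level_pair M (S (e, i, j)) (S (e, i + 1, j))) \<and>
     (\<forall>i\<le>N. \<forall>j<N. level_pair M (S (e, i, j)) (S (e, i, j + 1))) \<and>
     (\<forall>s. \<forall>t\<le>N. level_pair M (S (inner_node N e s t)) (S (outer_node N T e s t))))"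

end

theory Submission
  imports Defs
begin

text \<open>Three independent facts carry the theorem.

  At an interface between two nodal values of a lake at rest with levels \<open>C\<close>, the reconstruction is
  of one of two kinds. If the uppermost level \<open>C 1\<close> reaches the higher of the two bottoms, then both
  reconstructed bottoms equal the higher bottom \<open>B\<close> and both reconstructed surfaces equal
  \<open>max (C m) B\<close>, so that heights and pressures agree. Otherwise all reconstructed layers are dry on
  both sides. In either case the dissipation and the nonconservative product vanish, and the
  entropy conservative flux vanishes because the velocities do (\<open>interface_terms_vanish\<close>). This
  makes the finite volume update zero on every element, and the surface terms of the DG update too.

  The DG update enters only on elements whose layers are wet at all nodes. There the surface
  \<open>max (C m) b\<close> lies strictly above the bottom \<open>b\<close> and hence equals \<open>C m\<close> at both of two adjacent
  nodes; the surfaces are therefore constant on the element, and so are the pressures, which depend on the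
  surfaces only (\<open>press_eq_surf\<close>). Hence the volume terms vanish as well.

  What is left in both updates is the mass matrix applied to the time derivative, and the mass
  matrix is definite because the quadrature weights are positive. The same positivity puts the cell
  average of a layer above its nodal minimum, which is nonnegative, so the limiter factor is 1.
  Positivity of the weights (\<open>weight_pos\<close>) is the classical argument: the polynomial
  \<open>(X\<^sup>2 - 1) L\<^sub>N'\<close> vanishes at the nodes and is orthogonal to all polynomials of degree
  at most \<open>N - 2\<close>, so the quadrature is exact up to degree \<open>2 N - 1\<close>; it is then
  applied to a polynomial of that degree that is nonnegative on \<open>[-1, 1]\<close> and vanishes at all nodes
  but one.\<close>

section \<open>Orthogonality of the derivative of the Legendre polynomial\<close>

text \<open>The integral over the reference interval \<open>[-1, 1]\<close>, as a functional on polynomials.\<close>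
definition poly_integral :: "real poly \<Rightarrow> real" where
  "poly_integral p = integral {-1..1} (poly p)"

lemma poly_integrable: "poly (p :: real poly) integrable_on {a..b}"
  by (intro integrable_continuous_interval continuous_intros)

lemma poly_integral_add: "poly_integral (p + q) = poly_integral p + poly_integral q"
  unfolding poly_integral_def poly_add
  by (rule Henstock_Kurzweil_Integration.integral_add; rule poly_integrable)

lemma poly_integral_smult: "poly_integral (smult c p) = c * poly_integral p"
  using Henstock_Kurzweil_Integration.integral_mult_right[of "{-1..1}" c "poly p"]
  by (simp add: poly_integral_def poly_smult[abs_def])

lemma poly_integral_0: "poly_integral 0 = 0"
  using poly_integral_smult[of 0 0] by simp

lemma poly_integral_pderiv: "poly_integral (pderiv p) = poly p 1 - poly p (-1)"
proof -
  have "(poly (pderiv p) has_integral (poly p 1 - poly p (-1))) {-1..1}"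
    by (rule fundamental_theorem_of_calculus)
       (auto simp: has_real_derivative_iff_has_vector_derivative[symmetric]
             intro: has_field_derivative_at_within poly_DERIV)
  then show ?thesis
    unfolding poly_integral_def by (rule integral_unique)
qed

lemma poly_integral_by_parts:
  assumes "poly (p * q) 1 = 0" and "poly (p * q) (-1) = 0"
  shows "poly_integral (pderiv p * q) = - poly_integral (p * pderiv q)"
proof -
  have "poly_integral (p * pderiv q) + poly_integral (pderiv p * q) = poly_integral (pderiv (p * q))"
    by (simp add: pderiv_mult poly_integral_add mult.commute)
  also have "\<dots> = 0"
    unfolding poly_integral_pderiv assms by simp
  finally show ?thesis by simp
qed

lemma power_dvd_pderiv:
  fixes p q :: "real poly"
  assumes "q ^ Suc n dvd p"
  shows "q ^ n dvd pderiv p"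
proof -
  obtain r where r: "p = q ^ Suc n * r"
    using assms by (rule dvdE)
  show ?thesis
    unfolding r pderiv_mult pderiv_power_Suc by (intro dvd_add dvd_mult dvd_mult2 dvd_smult) auto
qed

lemma power_dvd_higher_pderiv:
  fixes q :: "real poly"
  assumes "k \<le> n"
  shows "q ^ (n - k) dvd (pderiv ^^ k) (q ^ n)"
  using assms
proof (induction k)
  case (Suc k)
  then have "q ^ Suc (n - Suc k) dvd (pderiv ^^ k) (q ^ n)"
    by (simp add: Suc_diff_Suc)
  then show ?case
    using power_dvd_pderiv by auto
qed simp

lemma rodrigues_orthogonal:
  assumes "k \<le> n" and "degree p < k"
  shows "poly_integral ((pderiv ^^ k) ([:-1, 0, 1:] ^ n) * p) = 0"
  using assms
proof (induction k arbitrary: p)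
  case (Suc k)
  let ?W = "(pderiv ^^ k) ([:-1, 0, 1:] ^ n) :: real poly"
  have "[:-1, 0, 1:] ^ 1 dvd ([:-1, 0, 1:] :: real poly) ^ (n - k)"
    using Suc.prems by (intro le_imp_power_dvd) auto
  then have "[:-1, 0, 1:] dvd ?W"
    using power_dvd_higher_pderiv[of k n "[:-1, 0, 1:]"] Suc.prems dvd_trans by fastforce
  then have "poly ?W 1 = 0" "poly ?W (-1) = 0"
    by (auto elim!: dvdE)
  then have parts: "poly_integral (pderiv ?W * p) = - poly_integral (?W * pderiv p)"
    by (intro poly_integral_by_parts) auto
  show ?case
  proof (cases "degree p = 0")
    case True
    then have "pderiv p = 0" by (simp add: pderiv_eq_0_iff)
    then show ?thesis using parts by (simp add: poly_integral_0)
  next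
    case False
    then have "degree (pderiv p) < k"
      using Suc.prems by (simp add: degree_pderiv)
    then show ?thesis using parts Suc by simp
  qed
qed simp

lemma degree_higher_pderiv:
  "degree ((pderiv ^^ k) (p :: real poly)) = degree p - k"
  by (induction k) (auto simp: degree_pderiv)

lemma degree_legendre: "degree (legendre n) = n"
proof -
  have "degree ([:-1, 0, 1:] ^ n :: real poly) = 2 * n"
    by (simp add: degree_power_eq)
  then show ?thesis
    by (simp add: legendre_def degree_higher_pderiv)
qed

lemma legendre_orthogonal:
  assumes "degree p < n"
  shows "poly_integral (legendre n * p) = 0"
  using rodrigues_orthogonal[OF order_refl assms]
  by (simp add: legendre_def poly_integral_smult)

lemma pderiv_legendre_orthogonal:
  assumes "degree p + 2 \<le> n"
  shows "poly_integral ([:-1, 0, 1:] * pderiv (legendre n) * p) = 0"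
proof -
  let ?r = "[:-1, 0, 1:] * p"
  have "degree ?r \<le> 2 + degree p"
    using degree_mult_le[of "[:-1, 0, 1:]" p] by simp
  then have "degree (pderiv ?r) < n"
    using assms by (subst degree_pderiv) linarith
  then have "poly_integral (legendre n * pderiv ?r) = 0"
    by (rule legendre_orthogonal)
  moreover have "poly_integral (pderiv (legendre n) * ?r) = - poly_integral (legendre n * pderiv ?r)"
    by (rule poly_integral_by_parts) auto
  ultimately show ?thesis
    by (simp only: mult.assoc mult.left_commute neg_equal_zero minus_zero)
qed

section \<open>Positivity of the quadrature weights\<close>

lemma lagrange_at_node:
  assumes "inj_on x {..N}" and "i \<le> N" and "j \<le> N"
  shows "poly (lagrange N x i) (x j) = (if i = j then 1 else 0)"
proof (cases "i = j")
  case True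
  have "poly (smult (1 / (x i - x k)) [:- x k, 1:]) (x i) = 1" if "k \<in> {..N} - {i}" for k
  proof -
    have "x i - x k \<noteq> 0"
      using that assms by (auto dest: inj_onD)
    then show ?thesis unfolding poly_smult by simp
  qed
  then show ?thesis
    using True unfolding lagrange_def poly_prod by (auto intro: prod.neutral)
next
  case False
  then have "\<exists>k\<in>{..N} - {i}. poly (smult (1 / (x i - x k)) [:- x k, 1:]) (x j) = 0"
    using assms by (intro bexI[of _ j]) auto
  then show ?thesis
    using False by (simp add: lagrange_def poly_prod)
qed

lemma degree_lagrange_le:
  assumes "i \<le> N"
  shows "degree (lagrange N x i) \<le> N"
proof -
  have "degree (lagrange N x i) \<le>
      (\<Sum>k\<in>{..N} - {i}. degree (smult (1 / (x i - x k)) [:- x k, 1:]))"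
    unfolding lagrange_def by (rule order_trans[OF degree_prod_sum_le]) (auto simp: o_def)
  also have "\<dots> \<le> (\<Sum>k\<in>{..N} - {i}. 1)"
    by (intro sum_mono) auto
  also have "\<dots> = N" using assms by simp
  finally show ?thesis .
qed

lemma lgl_nodes_inj: "lgl_nodes N x \<Longrightarrow> inj_on x {..N}"
  unfolding lgl_nodes_def using strict_mono_on_imp_inj_on by blast

lemma lgl_node_less: "lgl_nodes N x \<Longrightarrow> i < j \<Longrightarrow> j \<le> N \<Longrightarrow> x i < x j"
  unfolding lgl_nodes_def strict_mono_on_def by auto

lemma lgl_node_bounds:
  assumes "lgl_nodes N x" and "i \<le> N"
  shows "x i \<in> {-1..1}"
proof -
  have "x 0 \<le> x i"
    using lgl_node_less[OF assms(1), of 0 i] assms(2) by (cases "i = 0") auto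
  moreover have "x i \<le> x N"
    using lgl_node_less[OF assms(1), of i N] assms(2) by (cases "i = N") auto
  ultimately show ?thesis
    using assms(1) by (simp add: lgl_nodes_def)
qed

text \<open>Exactness of the quadrature up to degree \<open>2 N - 1\<close>, for a polynomial whose quadrature sum
  has a single term.\<close>
lemma lgl_quadrature_exact:
  assumes "1 \<le> N" and "lgl_nodes N x" and "i \<le> N" and "degree p \<le> 2 * N - 1"
    and "\<And>j. j \<le> N \<Longrightarrow> j \<noteq> i \<Longrightarrow> poly p (x j) = 0"
  shows "poly_integral p = weight N x i * poly p (x i)"
proof -
  let ?l = "smult (poly p (x i)) (lagrange N x i)"
  define w where "w = [:-1, 0, 1:] * pderiv (legendre N)"
  define r where "r = p - ?l"
  have inj: "inj_on x {..N}" by (rule lgl_nodes_inj[OF assms(2)])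
  have w_node: "poly w (x j) = 0" if "j \<le> N" for j
  proof -
    have "j = 0 \<or> j = N \<or> j \<in> {0<..<N}" using that by auto
    then show ?thesis
      using assms(2) unfolding w_def lgl_nodes_def by auto
  qed
  have r_node: "poly r (x j) = 0" if "j \<le> N" for j
    using that assms(3,5) lagrange_at_node[OF inj assms(3) that] by (auto simp: r_def)
  have "pderiv (legendre N) \<noteq> 0"
    using assms(1) by (simp add: pderiv_eq_0_iff degree_legendre)
  then have "w \<noteq> 0"
    unfolding w_def by (intro no_zero_divisors) auto
  have deg_w: "degree w = N + 1"
    unfolding w_def using assms(1) \<open>pderiv (legendre N) \<noteq> 0\<close>
    by (subst degree_mult_eq) (auto simp: degree_pderiv degree_legendre)
  have "degree r \<le> 2 * N - 1"
    unfolding r_def using assms(1,4) degree_lagrange_le[OF assms(3), of x]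
    by (intro degree_diff_le) (auto intro: order_trans[OF degree_smult_le])
  \<comment> \<open>The remainder has degree at most \<open>N\<close> and vanishes at the \<open>N + 1\<close> nodes.\<close>
  have "r mod w = 0"
  proof (rule ccontr)
    assume nz: "r mod w \<noteq> 0"
    have "x ` {..N} \<subseteq> {y. poly (r mod w) y = 0}"
    proof safe
      fix j assume "j \<le> N"
      have "poly r (x j) = poly (r div w * w + r mod w) (x j)" by simp
      then show "poly (r mod w) (x j) = 0"
        unfolding poly_add poly_mult using r_node w_node \<open>j \<le> N\<close> by simp
    qed
    then have "card (x ` {..N}) \<le> card {y. poly (r mod w) y = 0}"
      using poly_roots_finite[OF nz] by (rule card_mono[rotated])
    also have "\<dots> \<le> degree (r mod w)"
      by (rule card_poly_roots_bound[OF nz])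
    also have "\<dots> < N + 1"
      using degree_mod_less'[OF \<open>w \<noteq> 0\<close> nz] deg_w by simp
    finally show False
      using card_image[OF inj] by simp
  qed
  then have r_eq: "r = w * (r div w)"
    by (metis dvd_mult_div_cancel mod_0_imp_dvd)
  have "poly_integral r = 0"
  proof (cases "r div w = 0")
    case True
    then have "r = 0" using r_eq by simp
    then show ?thesis by (simp add: poly_integral_0)
  next
    case False
    then have "degree r = N + 1 + degree (r div w)"
      using \<open>w \<noteq> 0\<close> deg_w r_eq degree_mult_eq by metis
    then have "degree (r div w) + 2 \<le> N"
      using \<open>degree r \<le> 2 * N - 1\<close> by linarith
    then have "poly_integral (w * (r div w)) = 0"
      unfolding w_def by (rule pderiv_legendre_orthogonal)
    then show ?thesis using r_eq by simp
  qed
  moreover have "p = r + ?l" by (simp add: r_def)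
  ultimately have "poly_integral p = poly p (x i) * poly_integral (lagrange N x i)"
    by (metis poly_integral_add poly_integral_smult add_0)
  then show ?thesis
    by (simp add: poly_integral_def weight_def)
qed

lemma weight_pos:
  assumes "1 \<le> N" and "lgl_nodes N x" and "i \<le> N"
  shows "0 < weight N x i"
proof -
  \<comment> \<open>Cancelling from the square of the Lagrange polynomial one linear factor at an end point, which
    has constant sign on the interval, lowers the degree to \<open>2 N - 1\<close>.\<close>
  define e where "e = (if i = 0 then N else 0)"
  define s where "s = (if i = 0 then -1 else 1 :: real)"
  have e: "e \<le> N" "e \<noteq> i" using assms by (auto simp: e_def)
  have inj: "inj_on x {..N}" by (rule lgl_nodes_inj[OF assms(2)])
  let ?l = "lagrange N x i"
  have l_node: "poly ?l (x j) = (if i = j then 1 else 0)" if "j \<le> N" for j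
    by (rule lagrange_at_node[OF inj assms(3) that])
  then have "[:- x e, 1:] dvd ?l"
    using e by (simp add: poly_eq_0_iff_dvd[symmetric])
  then obtain q where q: "?l = [:- x e, 1:] * q" by (rule dvdE)
  define p where "p = smult s (?l * q)"
  have "?l \<noteq> 0" using l_node[OF assms(3)] by auto
  then have "q \<noteq> 0" using q by auto
  then have "degree ?l = 1 + degree q"
    unfolding q by (subst degree_mult_eq) auto
  moreover have "degree (?l * q) = degree ?l + degree q"
    using \<open>?l \<noteq> 0\<close> \<open>q \<noteq> 0\<close> by (rule degree_mult_eq)
  moreover have "degree p = degree (?l * q)"
    unfolding p_def by (simp add: s_def)
  ultimately have "degree p \<le> 2 * N - 1"
    using degree_lagrange_le[OF assms(3), of x] by linarith
  then have quad: "poly_integral p = weight N x i * poly p (x i)"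
    using l_node by (intro lgl_quadrature_exact[OF assms]) (auto simp: p_def)
  have p_eq: "poly p y = (s * (y - x e)) * (poly q y)\<^sup>2" for y
    unfolding p_def q by (simp add: power2_eq_square algebra_simps)
  have sgn: "0 \<le> s * (y - x e)" if "y \<in> {-1..1}" for y
    using that assms(2) by (auto simp: s_def e_def lgl_nodes_def)
  then have nonneg: "0 \<le> poly p y" if "y \<in> {-1..1}" for y
    unfolding p_eq using that by (intro mult_nonneg_nonneg[OF _ zero_le_power2])
  have "poly p (x i) \<noteq> 0"
  proof -
    have "(x i - x e) * poly q (x i) = 1"
      using l_node[OF assms(3)] unfolding q by (simp add: algebra_simps)
    then show ?thesis
      unfolding p_eq by (auto simp: s_def)
  qed
  moreover have node: "x i \<in> {-1..1}" by (rule lgl_node_bounds[OF assms(2,3)])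
  ultimately have "0 < poly p (x i)" using nonneg by force
  moreover have "0 < poly_integral p"
  proof -
    have "poly_integral p \<noteq> 0"
      unfolding poly_integral_def
      using integral_eq_0_iff[of "-1" 1 "poly p"] nonneg node \<open>poly p (x i) \<noteq> 0\<close>
        continuous_on_poly[OF continuous_on_id, of "{-1..1}" p]
      by auto
    moreover have "0 \<le> poly_integral p"
      unfolding poly_integral_def using nonneg by (intro integral_nonneg poly_integrable)
    ultimately show ?thesis by simp
  qed
  ultimately show ?thesis
    unfolding quad by (simp add: zero_less_mult_iff)
qed

lemma node_mass_pos:
  assumes "1 \<le> N" and "lgl_nodes N x" and "valid_mesh N x T" and "e < nelem T"
    and "i \<le> N" and "j \<le> N"
  shows "0 < Jn x T e i j * (weight N x i * weight N x j)"
proof -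
  have "0 < jac T e (x i) (x j)"
    using assms(3,4) lgl_node_bounds[OF assms(2)] assms(5,6) unfolding valid_mesh_def by blast
  then show ?thesis
    using weight_pos[OF assms(1,2)] assms(5,6) by (simp add: Jn_def)
qed

section \<open>Interfaces of a lake at rest\<close>

text \<open>The velocities of all layers vanish.\<close>
definition still :: "nat \<Rightarrow> nodal \<Rightarrow> bool" where
  "still M q \<longleftrightarrow> (\<forall>m\<in>{1..M}. vx q m = 0 \<and> vy q m = 0)"

lemma level_pair_sym: "level_pair M q q' \<Longrightarrow> level_pair M q' q"
  unfolding level_pair_def by blast

lemma ec_flux_still:
  "still M q \<Longrightarrow> still M q' \<Longrightarrow> m \<in> {1..M} \<Longrightarrow> ec_flux q q' d m = 0"
  by (simp add: still_def ec_flux_def avg_def Let_def vec_eq_iff forall_3)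

lemma still_recon: "still M (recon M q q') = still M q"
  by (simp add: still_def recon_def)

text \<open>Either the reconstructions agree in bottom and heights, or both are completely dry.\<close>
lemma recon_level_pair:
  assumes "level_pair M q q'"
  shows "(bed (recon M q q') = bed (recon M q' q) \<and>
           (\<forall>m\<in>{1..M}. ht (recon M q q') m = ht (recon M q' q) m)) \<or>
         (\<forall>m\<in>{1..M}. ht (recon M q q') m = 0 \<and> ht (recon M q' q) m = 0)"
proof (cases "1 \<le> M")
  case True
  obtain C where step: "\<And>m. m \<in> {1..<M} \<Longrightarrow> C (m + 1) \<le> C m"
    and surf: "\<And>m. m \<in> {1..M} \<Longrightarrow> surf M q m = max (C m) (bed q)"
    and surf': "\<And>m. m \<in> {1..M} \<Longrightarrow> surf M q' m = max (C m) (bed q')"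
    using assms unfolding level_pair_def by blast
  have top: "C m \<le> C 1" if "m \<in> {1..M}" for m
  proof -
    have "1 \<le> m" using that by simp
    then show ?thesis using that
    proof (induction m rule: dec_induct)
      case (step n)
      then show ?case using \<open>\<And>m. m \<in> {1..<M} \<Longrightarrow> C (m + 1) \<le> C m\<close>[of n] by auto
    qed simp
  qed
  have one: "surf M q 1 = max (C 1) (bed q)" "surf M q' 1 = max (C 1) (bed q')"
    using surf surf' True by auto
  show ?thesis
  proof (cases "max (bed q) (bed q') \<le> C 1")
    case wet: True
    let ?B = "max (bed q) (bed q')"
    have bed: "rec_bed M q q' = ?B" "rec_bed M q' q = ?B"
      using wet unfolding rec_bed_def one by auto
    have "rec_surf M q q' m = rec_surf M q' q m" if "m \<in> {1..M}" for m
      unfolding rec_surf_def bed surf[OF that] surf'[OF that] by auto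
    then show ?thesis
      using True by (intro disjI1) (auto simp: recon_def bed)
  next
    case dry: False
    have "rec_surf M q q' m = rec_bed M q q' \<and> rec_surf M q' q m = rec_bed M q' q"
      if "m \<in> {1..M}" for m
      using dry top[OF that] unfolding rec_surf_def rec_bed_def one surf[OF that] surf'[OF that]
      by auto
    then show ?thesis
      using True by (intro disjI2) (auto simp: recon_def)
  qed
qed simp

lemma press_cong:
  assumes "bed q = bed q'" and "\<And>k. k \<in> {1..M} \<Longrightarrow> ht q k = ht q' k" and "m \<in> {1..M}"
  shows "press M \<rho> q m = press M \<rho> q' m"
  using assms by (auto simp: press_def intro!: arg_cong2[of _ _ _ _ "(+)"] sum.cong)

lemma nc_term_eq_press:
  "press M \<rho> q m = press M \<rho> q' m \<Longrightarrow> nc_term g M \<rho> q q' d m = 0"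
  by (simp add: nc_term_def Rdot_def)

lemma nc_term_dry: "ht q m = 0 \<Longrightarrow> nc_term g M \<rho> q q' d m = 0"
  by (simp add: nc_term_def Phi_def vec_eq_iff forall_3)

lemma interface_terms_vanish:
  assumes "level_pair M q q'" and "still M q" and "still M q'" and "m \<in> {1..M}"
  shows "es_flux g M q q' n m = 0" and "nc_interface g M \<rho> q q' n m = 0"
proof -
  let ?r = "recon M q q'" and ?r' = "recon M q' q"
  have "ht ?r m = ht ?r' m"
    using recon_level_pair[OF assms(1)] assms(4) by auto
  then have "cons_var ?r' m = cons_var ?r m"
    using assms(2-4) by (simp add: cons_var_def still_def recon_def)
  moreover have "ec_flux ?r ?r' n m = 0"
    using assms(2-4) by (intro ec_flux_still) (auto simp: still_recon)
  ultimately show "es_flux g M q q' n m = 0"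
    by (simp add: es_flux_def)
  show "nc_interface g M \<rho> q q' n m = 0"
    using recon_level_pair[OF assms(1)]
  proof
    assume "bed ?r = bed ?r' \<and> (\<forall>m\<in>{1..M}. ht ?r m = ht ?r' m)"
    then show ?thesis
      unfolding nc_interface_def by (intro nc_term_eq_press press_cong assms(4)) auto
  next
    assume "\<forall>m\<in>{1..M}. ht ?r m = 0 \<and> ht ?r' m = 0"
    then show ?thesis
      unfolding nc_interface_def using assms(4) by (intro nc_term_dry) auto
  qed
qed

lemma lake_still:
  assumes "lake_at_rest M N T S" and "e < nelem T" and "i \<le> N" and "j \<le> N"
  shows "still M (S (e, i, j))"
  using assms unfolding lake_at_rest_def still_def by blast

lemma inner_node_still:
  assumes "lake_at_rest M N T S" and "e < nelem T" and "t \<le> N"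
  shows "still M (S (inner_node N e s t))"
  using assms by (cases s) (auto simp: inner_node_def intro: lake_still)

lemma outer_node_still:
  assumes "lake_at_rest M N T S" and "valid_mesh N x T" and "e < nelem T" and "t \<le> N"
  shows "still M (S (outer_node N T e s t))"
proof -
  obtain e' s' r where nbr: "nbr T e s = (e', s', r)"
    by (metis prod_cases3)
  then have "e' < nelem T"
    using assms(2,3) unfolding valid_mesh_def conforming_def by (metis (no_types, lifting) case_prod_conv)
  then show ?thesis
    using inner_node_still[OF assms(1), of e'] assms(4) by (simp add: outer_node_def nbr)
qed

lemma lake_level_pair_edge:
  assumes "lake_at_rest M N T S" and "e < nelem T" and "t \<le> N"
  shows "level_pair M (S (inner_node N e s t)) (S (outer_node N T e s t))"
  using assms unfolding lake_at_rest_def by blast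

lemma lake_edge_terms_vanish:
  fixes s :: side
  assumes "lake_at_rest M N T S" and "valid_mesh N x T" and "e < nelem T" and "t \<le> N"
    and "m \<in> {1..M}"
  defines "q \<equiv> S (inner_node N e s t)" and "q' \<equiv> S (outer_node N T e s t)"
  shows "es_flux g M q q' n m - flux q n m = 0" and "nc_interface g M \<rho> q q' n m = 0"
proof -
  have q: "still M q"
    unfolding q_def by (rule inner_node_still[OF assms(1,3,4)])
  have q': "still M q'"
    unfolding q'_def by (rule outer_node_still[OF assms(1-4)])
  have lp: "level_pair M q q'"
    unfolding q_def q'_def by (rule lake_level_pair_edge[OF assms(1,3,4)])
  have "flux q n m = 0"
    using q assms(5) by (simp add: flux_def still_def vec_eq_iff forall_3)
  then show "es_flux g M q q' n m - flux q n m = 0" "nc_interface g M \<rho> q q' n m = 0"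
    using interface_terms_vanish[OF lp q q' assms(5)] by auto
qed

section \<open>The two updates\<close>

lemma sub_outer_level_pair:
  assumes "lake_at_rest M N T S" and "valid_mesh N x T" and "e < nelem T" and "i \<le> N" and "j \<le> N"
  shows "level_pair M (S (e, i, j)) (S (sub_outer N T e i j s))"
    and "still M (S (sub_outer N T e i j s))"
proof -
  have xi: "level_pair M (S (e, k, j)) (S (e, k + 1, j))" if "k < N" for k
    using assms(1,3,5) that unfolding lake_at_rest_def by blast
  have eta: "level_pair M (S (e, i, k)) (S (e, i, k + 1))" if "k < N" for k
    using assms(1,3,4) that unfolding lake_at_rest_def by blast
  note edge = lake_level_pair_edge[OF assms(1,3), unfolded inner_node_def]
  show "level_pair M (S (e, i, j)) (S (sub_outer N T e i j s))"
  proof (cases s)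
    case West
    then show ?thesis
      using edge[of j West] level_pair_sym[OF xi[of "i - 1"]] assms(4,5) by (cases i) auto
  next
    case East
    then show ?thesis
      using edge[of j East] xi[of i] assms(4,5) by auto
  next
    case South
    then show ?thesis
      using edge[of i South] level_pair_sym[OF eta[of "j - 1"]] assms(4,5) by (cases j) auto
  next
    case North
    then show ?thesis
      using edge[of i North] eta[of j] assms(4,5) by auto
  qed
  show "still M (S (sub_outer N T e i j s))"
    using assms(4,5) outer_node_still[OF assms(1-3)] lake_still[OF assms(1,3)]
    by (cases s) auto
qed

lemma fv_update_lake_at_rest:
  assumes "1 \<le> N" and "lgl_nodes N x" and "valid_mesh N x T" and "lake_at_rest M N T S"
    and "e < nelem T" and "fv_update g M \<rho> N x T S e Ud"
    and "i \<le> N" and "j \<le> N" and "m \<in> {1..M}"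
  shows "Ud i j m = 0"
proof -
  note nbr = sub_outer_level_pair[OF assms(4,3,5,7,8)]
  have "es_flux g M (S (e, i, j)) (S (sub_outer N T e i j s)) n m = 0"
    "nc_interface g M \<rho> (S (e, i, j)) (S (sub_outer N T e i j s)) n m = 0" for s n
    by (rule interface_terms_vanish[OF nbr(1) lake_still[OF assms(4,5,7,8)] nbr(2) assms(9)])+
  then have "(Jn x T e i j * (weight N x i * weight N x j)) *\<^sub>R Ud i j m = 0"
    using assms(6-9) unfolding fv_update_def by (simp add: Let_def)
  then show ?thesis
    using node_mass_pos[OF assms(1-3,5,7,8)] by auto
qed

lemma surf_gt_bed:
  assumes "\<And>k. k \<in> {1..M} \<Longrightarrow> 0 < ht q k" and "m \<in> {1..M}"
  shows "bed q < surf M q m"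
proof -
  have "0 < (\<Sum>k=m..M. ht q k)"
    using assms by (intro sum_pos) auto
  then show ?thesis by (simp add: surf_def)
qed

lemma level_pair_wet_surf_eq:
  assumes "level_pair M q q'" and "m \<in> {1..M}"
    and "\<And>k. k \<in> {1..M} \<Longrightarrow> 0 < ht q k" and "\<And>k. k \<in> {1..M} \<Longrightarrow> 0 < ht q' k"
  shows "surf M q m = surf M q' m"
proof -
  obtain c where "surf M q m = max c (bed q)" "surf M q' m = max c (bed q')"
    using assms(1,2) unfolding level_pair_def by blast
  then show ?thesis
    using surf_gt_bed[OF assms(3,2)] surf_gt_bed[OF assms(4,2)] by (auto simp: max_def split: if_splits)
qed

text \<open>Bottom and heights enter the pressures only through the surfaces.\<close>
lemma press_eq_surf:
  assumes "m \<in> {1..M}"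
  shows "press M \<rho> q m = surf M q m + (\<Sum>k=1..<m. \<rho> k / \<rho> m * (surf M q k - surf M q (k + 1)))"
proof -
  have "ht q k = surf M q k - surf M q (k + 1)" if "k \<in> {1..<m}" for k
    using that assms by (simp add: surf_def sum.atLeast_Suc_atMost)
  then show ?thesis
    by (simp add: press_def surf_def)
qed

lemma wet_element_surf_const:
  assumes "lake_at_rest M N T S" and "e < nelem T"
    and wet: "\<And>i j k. i \<le> N \<Longrightarrow> j \<le> N \<Longrightarrow> k \<in> {1..M} \<Longrightarrow> 0 < ht (S (e, i, j)) k"
    and "i \<le> N" and "j \<le> N" and "m \<in> {1..M}"
  shows "surf M (S (e, i, j)) m = surf M (S (e, 0, 0)) m"
proof -
  have "surf M (S (e, i, j)) m = surf M (S (e, 0, j)) m"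
    using \<open>i \<le> N\<close>
  proof (induction i)
    case (Suc i)
    then have "level_pair M (S (e, i, j)) (S (e, i + 1, j))"
      using assms(1,2,5) unfolding lake_at_rest_def by simp
    then have "surf M (S (e, i, j)) m = surf M (S (e, i + 1, j)) m"
      using Suc.prems assms(5,6) by (intro level_pair_wet_surf_eq wet) auto
    then show ?case using Suc by simp
  qed simp
  moreover have "surf M (S (e, 0, j)) m = surf M (S (e, 0, 0)) m"
    using \<open>j \<le> N\<close>
  proof (induction j)
    case (Suc j)
    then have "level_pair M (S (e, 0, j)) (S (e, 0, j + 1))"
      using assms(1,2) unfolding lake_at_rest_def by simp
    then have "surf M (S (e, 0, j)) m = surf M (S (e, 0, j + 1)) m"
      using Suc.prems assms(6) by (intro level_pair_wet_surf_eq wet) auto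
    then show ?case using Suc by simp
  qed simp
  ultimately show ?thesis by simp
qed

lemma inner_N_zero_left:
  assumes "\<And>i j m. i \<le> N \<Longrightarrow> j \<le> N \<Longrightarrow> m \<in> {1..M} \<Longrightarrow> f i j m = 0"
  shows "inner_N M N x f \<phi> = 0"
  using assms unfolding inner_N_def by (intro sum.neutral ballI) simp

lemma surface_N_zero:
  assumes "\<And>s t m. t \<le> N \<Longrightarrow> m \<in> {1..M} \<Longrightarrow> f s t m = 0"
  shows "surface_N M N x T e \<phi> f = 0"
  using assms unfolding surface_N_def by (intro sum.neutral ballI) (simp split: prod.split)

lemma dg_update_lake_at_rest:
  assumes "1 \<le> N" and "lgl_nodes N x" and "valid_mesh N x T" and "lake_at_rest M N T S"
    and "e < nelem T" and "dg_update g M \<rho> N x T S e Ud"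
    and wet: "\<And>i j k. i \<le> N \<Longrightarrow> j \<le> N \<Longrightarrow> k \<in> {1..M} \<Longrightarrow> 0 < ht (S (e, i, j)) k"
    and "i \<le> N" and "j \<le> N" and "m \<in> {1..M}"
  shows "Ud i j m = 0"
proof -
  note still = lake_still[OF assms(4,5)]
  have press: "press M \<rho> (S (e, i, j)) m = press M \<rho> (S (e, k, l)) m"
    if "i \<le> N" "j \<le> N" "k \<le> N" "l \<le> N" "m \<in> {1..M}" for i j k l m
  proof -
    have "surf M (S (e, i, j)) n = surf M (S (e, k, l)) n" if "n \<in> {1..M}" for n
      using wet_element_surf_const[OF assms(4,5) wet \<open>i \<le> N\<close> \<open>j \<le> N\<close> that]
        wet_element_surf_const[OF assms(4,5) wet \<open>k \<le> N\<close> \<open>l \<le> N\<close> that]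
      by (rule trans[OF _ sym])
    then show ?thesis
      using that by (simp add: press_eq_surf)
  qed
  have vol1: "split_div N x T ec_flux S e i j m = 0"
    if "i \<le> N" "j \<le> N" "m \<in> {1..M}" for i j m
    using that still by (simp add: split_div_def ec_flux_still[of M])
  have vol2: "split_div N x T (nc_term g M \<rho>) S e i j m = 0"
    if "i \<le> N" "j \<le> N" "m \<in> {1..M}" for i j m
  proof -
    have "nc_term g M \<rho> (S (e, i, j)) (S (e, l, j)) d m = 0"
      "nc_term g M \<rho> (S (e, i, j)) (S (e, i, l)) d m = 0" if "l \<le> N" for l d
      using that \<open>i \<le> N\<close> \<open>j \<le> N\<close> \<open>m \<in> {1..M}\<close> by (blast intro: nc_term_eq_press press)+
    then show ?thesis by (simp add: split_div_def)
  qed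
  have "inner_N M N x (\<lambda>i j m. Jn x T e i j *\<^sub>R Ud i j m) \<phi> = 0" for \<phi>
  proof -
    have "surface_N M N x T e \<phi> (\<lambda>s t m.
         let q = S (inner_node N e s t); q' = S (outer_node N T e s t);
             n = sgn (side_normal N x T e s t)
         in es_flux g M q q' n m - flux q n m) = 0"
      "surface_N M N x T e \<phi> (\<lambda>s t m.
         let q = S (inner_node N e s t); q' = S (outer_node N T e s t);
             n = sgn (side_normal N x T e s t)
         in nc_interface g M \<rho> q q' n m) = 0"
      unfolding Let_def using lake_edge_terms_vanish[OF assms(4,3,5)]
      by (blast intro: surface_N_zero)+
    moreover have "inner_N M N x (split_div N x T ec_flux S e) \<phi> = 0"
      "inner_N M N x (split_div N x T (nc_term g M \<rho>) S e) \<phi> = 0"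
      using vol1 vol2 by (auto intro: inner_N_zero_left)
    ultimately show ?thesis
      using assms(6)[unfolded dg_update_def, THEN spec, of \<phi>] by (simp only: add_0_right)
  qed
  \<comment> \<open>Testing with the update itself gives its squared norm in the mass matrix.\<close>
  from this[of Ud]
  have sum0: "(\<Sum>i\<le>N. \<Sum>j\<le>N. (Jn x T e i j * (weight N x i * weight N x j)) *
      (\<Sum>m=1..M. (norm (Ud i j m))\<^sup>2)) = 0"
    by (simp add: inner_N_def dot_square_norm sum_distrib_left[symmetric] mult_ac)
  have nn: "0 \<le> (Jn x T e i j * (weight N x i * weight N x j)) * (\<Sum>m=1..M. (norm (Ud i j m))\<^sup>2)"
    if "i \<le> N" "j \<le> N" for i j
    by (rule mult_nonneg_nonneg[OF less_imp_le[OF node_mass_pos[OF assms(1-3,5) that]]])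
       (auto intro: sum_nonneg)
  have "(\<Sum>j\<le>N. (Jn x T e i j * (weight N x i * weight N x j)) *
      (\<Sum>m=1..M. (norm (Ud i j m))\<^sup>2)) = 0"
    by (rule sum_nonneg_0[OF _ _ sum0]) (use nn assms(8) in \<open>auto intro!: sum_nonneg\<close>)
  then have "(Jn x T e i j * (weight N x i * weight N x j)) * (\<Sum>m=1..M. (norm (Ud i j m))\<^sup>2) = 0"
    by (rule sum_nonneg_0[rotated 2]) (use nn assms(8,9) in auto)
  then have "(\<Sum>m=1..M. (norm (Ud i j m))\<^sup>2) = 0"
    using node_mass_pos[OF assms(1-3,5,8,9)] by auto
  then have "(norm (Ud i j m))\<^sup>2 = 0"
    by (rule sum_nonneg_0[rotated 2]) (use assms(10) in auto)
  then show ?thesis by simp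
qed

section \<open>The limiter\<close>

lemma limiter_theta_nonneg:
  assumes "1 \<le> N" and "lgl_nodes N x" and "valid_mesh N x T" and "e < nelem T"
    and nonneg: "\<And>i j. i \<le> N \<Longrightarrow> j \<le> N \<Longrightarrow> 0 \<le> ht (S (e, i, j)) m"
  shows "limiter_theta N x T S e m = 1"
proof -
  let ?w = "\<lambda>i j. Jn x T e i j * (weight N x i * weight N x j)"
  let ?h = "\<lambda>i j. ht (S (e, i, j)) m"
  define c where "c = Min ((\<lambda>(i, j). ?h i j) ` ({..N} \<times> {..N}))"
  note mass = node_mass_pos[OF assms(1-4)]
  have c_le: "c \<le> ?h i j" if "i \<le> N" "j \<le> N" for i j
    unfolding c_def by (rule Min_le) (use that in auto)
  have "0 \<le> c"
    unfolding c_def using nonneg by (subst Min_ge_iff) auto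
  have total: "0 < (\<Sum>i\<le>N. \<Sum>j\<le>N. ?w i j)"
    using mass by (intro sum_pos) auto
  have "c * (\<Sum>i\<le>N. \<Sum>j\<le>N. ?w i j) = (\<Sum>i\<le>N. \<Sum>j\<le>N. ?w i j * c)"
    by (simp add: sum_distrib_left mult.commute)
  also have "\<dots> \<le> (\<Sum>i\<le>N. \<Sum>j\<le>N. ?w i j * ?h i j)"
    using c_le mass by (intro sum_mono mult_left_mono) (auto intro: less_imp_le)
  finally have "c \<le> cell_avg N x T S e m"
    using total by (simp add: cell_avg_def pos_le_divide_eq)
  then show ?thesis
    using \<open>0 \<le> c\<close> unfolding limiter_theta_def Let_def c_def[symmetric]
    by (auto simp: min_def field_simps)
qed

section \<open>Preservation of the lake at rest\<close>

theorem lemma12: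
  fixes g \<tau> :: real and M N :: nat and \<rho> x ind :: "nat \<Rightarrow> real"
    and T :: mesh and S :: state and Ud :: "nat \<Rightarrow> field"
  assumes "1 \<le> M" and "0 < g"
    and "0 < \<rho> 1" and "\<forall>m\<in>{1..<M}. \<rho> m < \<rho> (m + 1)"
    and "1 \<le> N" and "lgl_nodes N x" and "valid_mesh N x T"
    and "0 < \<tau>" and "\<forall>e<nelem T. 0 \<le> ind e \<and> ind e \<le> 1"
    and "lake_at_rest M N T S"
    and "semidiscrete_update g M \<rho> N x T \<tau> ind S Ud"
  shows "\<forall>e<nelem T. \<forall>i\<le>N. \<forall>j\<le>N. \<forall>m\<in>{1..M}.
           Ud e i j m = 0 \<and> limited N x T S e i j m = cons_var (S (e, i, j)) m"
proof (intro allI impI ballI conjI)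
  fix e i j m
  assume e: "e < nelem T" and ij: "i \<le> N" "j \<le> N" and m: "m \<in> {1..M}"
  let ?\<alpha> = "blending M N \<tau> ind S e"
  obtain UDG UFV where DG: "dg_update g M \<rho> N x T S e UDG" and FV: "fv_update g M \<rho> N x T S e UFV"
    and Ud: "Ud e i j m = (1 - ?\<alpha>) *\<^sub>R UDG i j m + ?\<alpha> *\<^sub>R UFV i j m"
    using assms(11) e ij m unfolding semidiscrete_update_def by blast
  have "UFV i j m = 0"
    by (rule fv_update_lake_at_rest[OF assms(5-7,10) e FV ij m])
  moreover have "?\<alpha> = 1 \<or> UDG i j m = 0"
  proof (cases "partially_dry M N \<tau> S e")
    case True
    then show ?thesis by (simp add: blending_def)
  next
    case False
    then have "0 < ht (S (e, i, j)) k" if "i \<le> N" "j \<le> N" "k \<in> {1..M}" for i j k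
      using that assms(8) unfolding partially_dry_def by force
    then have "UDG i j m = 0"
      using dg_update_lake_at_rest[OF assms(5-7,10) e DG _ ij m] by blast
    then show ?thesis ..
  qed
  ultimately show "Ud e i j m = 0"
    using Ud by auto
  have "0 \<le> ht (S (e, i, j)) m" if "i \<le> N" "j \<le> N" for i j
    using assms(10) e m that unfolding lake_at_rest_def by blast
  then have "limiter_theta N x T S e m = 1"
    by (rule limiter_theta_nonneg[OF assms(5-7) e])
  then show "limited N x T S e i j m = cons_var (S (e, i, j)) m"
    by (simp add: limited_def cons_var_def Let_def)
qed

end
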